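(* Let $n\ge 1$ be an integer. For a vector $d\in\mathbb{R}^{E_n}$ the following statements are equivalent: 1) $d\in\mathrm{CUT}(n)$; 2) there exist a probability space $(\Omega,\mathcal{A},\nu)$ and events $A_1,\ldots,A_n\in\mathcal{A}$ such that $\nu(A_i)=\tfrac12$ for all $1\le i\le n$ and $d_{ij}=\nu(A_i\triangle A_j)$ for all $1\le i<j\le n$.
   Context: $E_n = \{(i,j) : 1 \le i < j \le n\}$ is the edge set of the complete graph on $[n]=\{1,\ldots,n\}$. For $S\subseteq[n]$ the cut vector $\delta(S)\in\{0,1\}^{E_n}$ is defined by $\delta(S)_{ij}=1$ if $|S\cap\{i,j\}|=1$ and $\delta(S)_{ij}=0$ otherwise. The cut polytope is $\mathrm{CUT}(n)=\operatorname{conv}\{\delta(S): S\subseteq[n]\}\subseteq\mathbb{R}^{E_n}$. $A\triangle B=(A\setminus B)\cup(B\setminus A)$ denotes symmetric difference. *)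

theory Defs
  imports
    "HOL-Probability.Probability"
    "HOL-Analysis.Finite_Function_Topology"
begin

definition edges :: "nat \<Rightarrow> (nat \<times> nat) set" where
  "edges n = {(i, j). 1 \<le> i \<and> i < j \<and> j \<le> n}"

lemma finite_edges [simp]: "finite (edges n)"
  by (rule finite_subset[of _ "{..n} \<times> {..n}"]) (auto simp: edges_def)

text \<open>
  The type of finitely supported functions is a real vector space, so the library's
  convex hull operator applies to it.  The space of real vectors indexed by
  \<open>edges n\<close> is the subspace of functions supported in \<open>edges n\<close>; this lets the
  dimension depend on a natural number.
\<close>

definition edge_space :: "nat \<Rightarrow> ((nat \<times> nat) \<Rightarrow>\<^sub>0 real) set" where
  "edge_space n = {d. Poly_Mapping.keys d \<subseteq> edges n}"

lift_definition cut_vector :: "nat \<Rightarrow> nat set \<Rightarrow> (nat \<times> nat) \<Rightarrow>\<^sub>0 real" is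
  "\<lambda>n S (i, j). if (i, j) \<in> edges n \<and> card (S \<inter> {i, j}) = 1 then 1 else 0"
proof -
  fix n S
  show "finite {e. (case e of (i, j) \<Rightarrow>
      if (i, j) \<in> edges n \<and> card (S \<inter> {i, j}) = 1 then 1 else 0) \<noteq> (0::real)}"
    by (rule finite_subset[OF _ finite_edges[of n]]) (auto split: if_splits)
qed

definition cut_polytope :: "nat \<Rightarrow> ((nat \<times> nat) \<Rightarrow>\<^sub>0 real) set" where
  "cut_polytope n = convex hull (cut_vector n ` Pow {1..n})"

definition realized_by_half_events ::
    "nat \<Rightarrow> ((nat \<times> nat) \<Rightarrow>\<^sub>0 real) \<Rightarrow> 'w measure \<Rightarrow> (nat \<Rightarrow> 'w set) \<Rightarrow> bool" where
  "realized_by_half_events n d M A \<longleftrightarrow>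
     prob_space M \<and>
     (\<forall>i\<in>{1..n}. A i \<in> sets M) \<and>
     (\<forall>i\<in>{1..n}. measure M (A i) = 1/2) \<and>
     (\<forall>(i, j)\<in>edges n. Poly_Mapping.lookup d (i, j) = measure M (sym_diff (A i) (A j)))"

end

theory Submission
  imports Defs
begin

text \<open>
  A point of the cut polytope is a mixture of cuts, i.e. the law of a random subset of
  \<open>{1..n}\<close>.  Replacing the random set by its complement with probability one half leaves
  the cut vector unchanged and makes every vertex belong to the random set with probability
  one half; the events are \<open>A i = {S. i \<in> S}\<close>.  Conversely, events \<open>A i\<close> define the random
  set \<open>{i. x \<in> A i}\<close>, whose law provides the coefficients of the mixture.
\<close>

lemma lookup_scaleR: "Poly_Mapping.lookup (r *\<^sub>R x) i = r *\<^sub>R Poly_Mapping.lookup x i"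
proof -
  have "finite {i. r *\<^sub>R Poly_Mapping.lookup x i \<noteq> 0}"
    by (rule finite_subset[of _ "Poly_Mapping.keys x"]) (auto simp: in_keys_iff)
  then show ?thesis
    by (simp add: scaleR_poly_mapping_def)
qed

text \<open>The weights are indexed by \<open>I\<close> and not by the points \<open>f i\<close>,
  since \<open>f\<close> need not be injective: a set and its complement give the same cut vector.
  The right-hand side is convex, contains every \<open>f i\<close>, and lies in every convex set
  that does.\<close>

lemma convex_hull_finite_image:
  fixes f :: "'a \<Rightarrow> 'b::real_vector"
  assumes "finite I"
  shows "convex hull (f ` I) =
    {\<Sum>i\<in>I. c i *\<^sub>R f i | c. (\<forall>i\<in>I. c i \<ge> 0) \<and> sum c I = 1}" (is "_ = ?R")
proof (rule hull_unique)
  show "f ` I \<subseteq> ?R"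
  proof
    fix y assume "y \<in> f ` I"
    then obtain k where k: "k \<in> I" "y = f k" by blast
    let ?c = "\<lambda>i. if i = k then 1 else 0 :: real"
    have "y = (\<Sum>i\<in>I. ?c i *\<^sub>R f i)"
      using k assms by (simp add: if_distrib[of "\<lambda>r. r *\<^sub>R _"] cong: if_cong)
    moreover have "sum ?c I = 1"
      using k assms by simp
    ultimately show "y \<in> ?R"
      by (auto intro!: exI[of _ ?c])
  qed
next
  show "convex ?R"
  proof (rule convexI)
    fix x y u v assume "x \<in> ?R" "y \<in> ?R" and uv: "0 \<le> u" "0 \<le> v" "u + v = (1::real)"
    then obtain a b
      where a: "\<forall>i\<in>I. a i \<ge> 0" "sum a I = 1" "x = (\<Sum>i\<in>I. a i *\<^sub>R f i)"
        and b: "\<forall>i\<in>I. b i \<ge> 0" "sum b I = 1" "y = (\<Sum>i\<in>I. b i *\<^sub>R f i)"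
      by blast
    let ?c = "\<lambda>i. u * a i + v * b i"
    have "u *\<^sub>R x + v *\<^sub>R y = (\<Sum>i\<in>I. ?c i *\<^sub>R f i)"
      by (simp add: a b scaleR_sum_right sum.distrib scaleR_add_left)
    moreover have "sum ?c I = 1"
      using a b uv by (simp add: sum.distrib flip: sum_distrib_left)
    ultimately show "u *\<^sub>R x + v *\<^sub>R y \<in> ?R"
      using a b uv by (auto intro!: exI[of _ ?c])
  qed
next
  fix T assume T: "f ` I \<subseteq> T" "convex T"
  show "?R \<subseteq> T"
    using T assms by (auto intro!: convex_sum)
qed

text \<open>Finite additivity over the disjoint fibres of \<open>f\<close>. With the fibres as
  weights, the sum has the same shape as the coordinate of a mixture of cuts.\<close>

lemma (in finite_measure) measure_eq_sum_fibres:
  assumes "finite K" "\<And>x. x \<in> space M \<Longrightarrow> f x \<in> K"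
    and "\<And>k. k \<in> K \<Longrightarrow> {x \<in> space M. f x = k} \<in> sets M"
  shows "measure M {x \<in> space M. P (f x)} =
    (\<Sum>k\<in>K. measure M {x \<in> space M. f x = k} * of_bool (P k))"
proof -
  let ?F = "\<lambda>k. {x \<in> space M. f x = k}" and ?K = "{k \<in> K. P k}"
  have "{x \<in> space M. P (f x)} = (\<Union>k\<in>?K. ?F k)"
    using assms(2) by auto
  also have "measure M \<dots> = (\<Sum>k\<in>?K. measure M (?F k))"
    using assms by (intro finite_measure_finite_Union) (auto simp: disjoint_family_on_def)
  also have "\<dots> = (\<Sum>k\<in>K. measure M (?F k) * of_bool (P k))"
    using assms(1) by (simp add: sum.inter_filter of_bool_def if_distrib cong: if_cong)
  finally show ?thesis .
qed

lemma card_Int_pair_eq_1_iff: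
  "i \<noteq> j \<Longrightarrow> card (S \<inter> {i, j}) = 1 \<longleftrightarrow> (i \<in> S) \<noteq> (j \<in> S)"
  by (cases "i \<in> S"; cases "j \<in> S") (auto simp: Int_insert_right)

lemma lookup_cut_vector:
  "Poly_Mapping.lookup (cut_vector n S) (i, j) =
    of_bool ((i, j) \<in> edges n \<and> (i \<in> S) \<noteq> (j \<in> S))"
proof (cases "(i, j) \<in> edges n")
  case True
  then have "i \<noteq> j" by (auto simp: edges_def)
  with True show ?thesis
    by (simp add: cut_vector.rep_eq card_Int_pair_eq_1_iff del: One_nat_def)
qed (simp add: cut_vector.rep_eq)

text \<open>Off \<open>edges n\<close> both \<open>d\<close> and all cut vectors vanish, so vector
  equality reduces to the edge coordinates. Membership thus becomes the existence of a probability
  weight on subsets, the form used in both directions.\<close>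

lemma mem_cut_polytope_iff:
  assumes "d \<in> edge_space n"
  shows "d \<in> cut_polytope n \<longleftrightarrow>
    (\<exists>c. (\<forall>S\<in>Pow {1..n}. c S \<ge> 0) \<and> sum c (Pow {1..n}) = 1 \<and>
      (\<forall>(i, j)\<in>edges n. Poly_Mapping.lookup d (i, j) =
        (\<Sum>S\<in>Pow {1..n}. c S * of_bool ((i \<in> S) \<noteq> (j \<in> S)))))"
proof -
  have "d = (\<Sum>S\<in>Pow {1..n}. c S *\<^sub>R cut_vector n S) \<longleftrightarrow>
      (\<forall>(i, j)\<in>edges n. Poly_Mapping.lookup d (i, j) =
        (\<Sum>S\<in>Pow {1..n}. c S * of_bool ((i \<in> S) \<noteq> (j \<in> S))))" (is "?l \<longleftrightarrow> ?r") for c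
  proof
    assume ?l
    then show ?r
      by (auto simp: lookup_sum lookup_scaleR lookup_cut_vector)
  next
    assume r: ?r
    show ?l
    proof (rule poly_mapping_eqI)
      fix e :: "nat \<times> nat"
      obtain i j where e: "e = (i, j)" by (cases e)
      show "Poly_Mapping.lookup d e =
          Poly_Mapping.lookup (\<Sum>S\<in>Pow {1..n}. c S *\<^sub>R cut_vector n S) e"
      proof (cases "e \<in> edges n")
        case True
        with r e show ?thesis
          by (auto simp: lookup_sum lookup_scaleR lookup_cut_vector)
      next
        case False
        with assms have "Poly_Mapping.lookup d e = 0"
          by (auto simp: edge_space_def in_keys_iff)
        with False e show ?thesis
          by (simp add: lookup_sum lookup_scaleR lookup_cut_vector)
      qed
    qed
  qed
  then show ?thesis
    by (auto simp: cut_polytope_def convex_hull_finite_image)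
qed

lemma realized_imp_mem_cut_polytope:
  assumes "realized_by_half_events n d M A" "d \<in> edge_space n"
  shows "d \<in> cut_polytope n"
proof -
  interpret prob_space M
    using assms(1) by (simp add: realized_by_half_events_def)
  have A: "A i \<in> sets M" if "i \<in> {1..n}" for i
    using assms(1) that by (auto simp: realized_by_half_events_def)
  define f where "f x = {i \<in> {1..n}. x \<in> A i}" for x
  define c where "c S = measure M {x \<in> space M. f x = S}" for S
  have fibre: "{x \<in> space M. f x = S} \<in> sets M" if "S \<in> Pow {1..n}" for S
  proof -
    \<comment> \<open>The fibre is a finite intersection of events \<open>A i\<close> and their
      complements, hence measurable.\<close>
    have "{x \<in> space M. f x = S} = {x \<in> space M. \<forall>i\<in>{1..n}. x \<in> A i \<longleftrightarrow> i \<in> S}"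
      using that by (auto simp: f_def)
    also have "\<dots> \<in> sets M"
    proof (rule sets.sets_Collect_finite_All)
      fix i assume i: "i \<in> {1..n}"
      have "{x \<in> space M. x \<in> A i \<longleftrightarrow> i \<in> S} = (if i \<in> S then A i else space M - A i)"
        using sets.sets_into_space[OF A[OF i]] by auto
      then show "{x \<in> space M. x \<in> A i \<longleftrightarrow> i \<in> S} \<in> sets M"
        using A[OF i] by auto
    qed simp
    finally show ?thesis .
  qed
  have sum: "measure M {x \<in> space M. P (f x)} = (\<Sum>S\<in>Pow {1..n}. c S * of_bool (P S))" for P
    unfolding c_def by (rule measure_eq_sum_fibres) (use fibre in \<open>auto simp: f_def\<close>)
  have "sum c (Pow {1..n}) = 1"
    \<comment> \<open>The always true predicate yields the total mass.\<close>
    using sum[of "\<lambda>_. True"] prob_space by simp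
  moreover have "Poly_Mapping.lookup d (i, j) =
      (\<Sum>S\<in>Pow {1..n}. c S * of_bool ((i \<in> S) \<noteq> (j \<in> S)))" if "(i, j) \<in> edges n" for i j
  proof -
    from that have ij: "i \<in> {1..n}" "j \<in> {1..n}" by (auto simp: edges_def)
    have "Poly_Mapping.lookup d (i, j) = measure M (sym_diff (A i) (A j))"
      using assms(1) that by (auto simp: realized_by_half_events_def)
    also have "sym_diff (A i) (A j) = {x \<in> space M. (i \<in> f x) \<noteq> (j \<in> f x)}"
      using ij sets.sets_into_space[OF A[OF ij(1)]] sets.sets_into_space[OF A[OF ij(2)]]
      by (auto simp: f_def)
    finally show ?thesis
      by (simp only: sum[of "\<lambda>S. (i \<in> S) \<noteq> (j \<in> S)"])
  qed
  ultimately show ?thesis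
    unfolding mem_cut_polytope_iff[OF assms(2)] by (intro exI[of _ c]) (auto simp: c_def)
qed

lemma ex_pmf_finite_weights:
  fixes w :: "'a \<Rightarrow> real"
  assumes "finite I" "\<And>i. i \<in> I \<Longrightarrow> w i \<ge> 0" "sum w I = 1"
  shows "\<exists>p. \<forall>P. measure (measure_pmf p) {x. P x} = (\<Sum>i\<in>I. w i * of_bool (P i))"
proof -
  \<comment> \<open>\<open>embed_pmf\<close> takes a density on the whole type, so the weights are
    extended by zero.\<close>
  define v where "v i = (if i \<in> I then w i else 0)" for i
  have "(\<integral>\<^sup>+i. ennreal (v i) \<partial>count_space UNIV) = (\<Sum>i\<in>I. ennreal (v i))"
    using assms(1) by (intro nn_integral_count_space') (auto simp: v_def)
  also have "\<dots> = ennreal (\<Sum>i\<in>I. w i)"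
    using assms(2) by (subst sum_ennreal[symmetric]) (auto simp: v_def intro!: sum.cong)
  finally have *: "(\<integral>\<^sup>+i. ennreal (v i) \<partial>count_space UNIV) = 1"
    using assms(3) by simp
  have v0: "\<And>i. v i \<ge> 0" using assms(2) by (simp add: v_def)
  define p where "p = embed_pmf v"
  have pmf: "pmf p i = v i" for i
    unfolding p_def by (rule pmf_embed_pmf[OF v0 *])
  have "measure (measure_pmf p) {x. P x} = (\<Sum>i\<in>I. w i * of_bool (P i))" for P
  proof -
    \<comment> \<open>The event can be cut down to a finite subset of \<open>I\<close>, where its
      probability is a plain sum.\<close>
    have "set_pmf p \<subseteq> I"
      by (auto simp: set_pmf_iff pmf v_def split: if_splits)
    then have "{x. P x} \<inter> set_pmf p = {i \<in> I. P i} \<inter> set_pmf p" by auto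
    then have "measure (measure_pmf p) {x. P x} = measure (measure_pmf p) {i \<in> I. P i}"
      by (metis measure_Int_set_pmf)
    also have "\<dots> = (\<Sum>i\<in>{i \<in> I. P i}. w i)"
      using assms(1) by (simp add: measure_measure_pmf_finite pmf v_def)
    also have "\<dots> = (\<Sum>i\<in>I. w i * of_bool (P i))"
      using assms(1) by (simp add: sum.inter_filter of_bool_def if_distrib cong: if_cong)
    finally show ?thesis .
  qed
  then show ?thesis by blast
qed

lemma sum_Pow_complement: "(\<Sum>S\<in>Pow U. g (U - S)) = (\<Sum>S\<in>Pow U. g S)"
  by (rule sum.reindex_bij_witness[of _ "\<lambda>S. U - S" "\<lambda>S. U - S"]) auto

text \<open>Complementation permutes \<open>Pow U\<close>, so averaging over it can be moved from
  the weights to the function \<open>g\<close>. It then suffices to average the indicators of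
  interest.\<close>

lemma sum_Pow_symmetrized:
  fixes c g :: "'a set \<Rightarrow> real"
  shows "(\<Sum>S\<in>Pow U. (c S + c (U - S)) / 2 * g S) = (\<Sum>S\<in>Pow U. c S * ((g S + g (U - S)) / 2))"
proof -
  \<comment> \<open>Writing \<open>S\<close> as a double complement makes the summand a function of
    \<open>U - S\<close> alone.\<close>
  have "(\<Sum>S\<in>Pow U. c (U - S) * g S) = (\<Sum>S\<in>Pow U. c (U - S) * g (U - (U - S)))"
    by (intro sum.cong) (auto simp: double_diff)
  also have "\<dots> = (\<Sum>S\<in>Pow U. c S * g (U - S))"
    by (rule sum_Pow_complement)
  finally show ?thesis
    by (simp add: add_divide_distrib distrib_left distrib_right sum.distrib flip: sum_divide_distrib)
qed

lemma mem_cut_polytope_imp_realized: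
  assumes "d \<in> cut_polytope n" "d \<in> edge_space n"
  shows "\<exists>(M :: nat measure) A. realized_by_half_events n d M A"
proof -
  let ?U = "{1..n}"
  obtain c where c: "\<And>S. S \<in> Pow ?U \<Longrightarrow> c S \<ge> 0" "sum c (Pow ?U) = 1"
    "\<And>i j. (i, j) \<in> edges n \<Longrightarrow> Poly_Mapping.lookup d (i, j) =
        (\<Sum>S\<in>Pow ?U. c S * of_bool ((i \<in> S) \<noteq> (j \<in> S)))"
    using assms(1) unfolding mem_cut_polytope_iff[OF assms(2)] by blast
  \<comment> \<open>The law of the random set after it is complemented with probability one
    half.\<close>
  define w where "w S = (c S + c (?U - S)) / 2" for S
  have w: "(\<Sum>S\<in>Pow ?U. w S * g S) = (\<Sum>S\<in>Pow ?U. c S * ((g S + g (?U - S)) / 2))" for g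
    unfolding w_def by (rule sum_Pow_symmetrized)
  have "sum w (Pow ?U) = 1"
    using w[of "\<lambda>_. 1"] c(2) by simp
  moreover have "w S \<ge> 0" if "S \<in> Pow ?U" for S
    using that c(1)[of S] c(1)[of "?U - S"] by (auto simp: w_def)
  ultimately obtain p where p: "\<And>P. measure (measure_pmf p) {S. P S} =
      (\<Sum>S\<in>Pow ?U. w S * of_bool (P S))"
    using ex_pmf_finite_weights[of "Pow ?U" w] by auto
  \<comment> \<open>Decoding inverts encoding only on finite sets; all sets carrying weight are
    subsets of \<open>{1..n}\<close>, so this is enough.\<close>
  have fin: "measure (measure_pmf p) {S. P (set_decode (set_encode S))} =
      measure (measure_pmf p) {S. P S}" for P
    unfolding p by (intro sum.cong) (auto dest: finite_subset)
  \<comment> \<open>Binary coding of finite sets moves the law to \<open>nat\<close>, the type of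
    sample points demanded by the statement.\<close>
  define M where "M = measure_pmf (map_pmf set_encode p)"
  define A where "A i = {k. i \<in> set_decode k}" for i
  have M: "measure M {k. P (set_decode k)} = (\<Sum>S\<in>Pow ?U. w S * of_bool (P S))" for P
    using fin[of P] by (simp add: M_def vimage_def p)
  have "measure M (A i) = 1/2" if "i \<in> ?U" for i
  proof -
    have "measure M (A i) =
        (\<Sum>S\<in>Pow ?U. c S * ((of_bool (i \<in> S) + of_bool (i \<in> ?U - S)) / 2))"
      unfolding A_def M by (rule w)
    \<comment> \<open>Each \<open>i\<close> lies in exactly one of \<open>S\<close> and its
      complement, so the two indicators add up to 1.\<close>
    also have "\<dots> = (\<Sum>S\<in>Pow ?U. c S * (1/2))"
      using that by (intro sum.cong) auto
    finally show ?thesis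
      using c(2) by (simp flip: sum_divide_distrib)
  qed
  moreover have "Poly_Mapping.lookup d (i, j) = measure M (sym_diff (A i) (A j))"
    if ij: "(i, j) \<in> edges n" for i j
  proof -
    have "sym_diff (A i) (A j) = {k. (i \<in> set_decode k) \<noteq> (j \<in> set_decode k)}"
      by (auto simp: A_def)
    then have "measure M (sym_diff (A i) (A j)) =
        (\<Sum>S\<in>Pow ?U. c S * ((of_bool ((i \<in> S) \<noteq> (j \<in> S)) +
          of_bool ((i \<in> ?U - S) \<noteq> (j \<in> ?U - S))) / 2))"
      by (simp only: M[of "\<lambda>S. (i \<in> S) \<noteq> (j \<in> S)"] w)
    \<comment> \<open>Complementing flips both memberships, so \<open>S\<close> and its complement
      separate the same pairs and averaging changes nothing.\<close>
    also have "\<dots> = (\<Sum>S\<in>Pow ?U. c S * of_bool ((i \<in> S) \<noteq> (j \<in> S)))"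
      using ij by (intro sum.cong) (auto simp: edges_def)
    finally show ?thesis
      using c(3)[OF ij] by simp
  qed
  moreover have "prob_space M"
    unfolding M_def by (rule measure_pmf.prob_space_axioms)
  moreover have "A i \<in> sets M" for i
    by (simp add: M_def)
  ultimately have "realized_by_half_events n d M A"
    by (auto simp: realized_by_half_events_def)
  then show ?thesis by blast
qed

(* HOL cannot quantify over the type of sample points inside a formula.  The first conjunct
   is the equivalence with sample spaces in nat; the second extends the implication from
   2) to 1) to probability spaces over an arbitrary type 'w. *)
theorem corollary1:
  fixes n :: nat and d :: "(nat \<times> nat) \<Rightarrow>\<^sub>0 real"
  assumes "n \<ge> 1" and "d \<in> edge_space n"
  shows "(d \<in> cut_polytope n \<longleftrightarrow>
            (\<exists>(M :: nat measure) A. realized_by_half_events n d M A)) \<and>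
         ((\<exists>(M :: 'w measure) A. realized_by_half_events n d M A) \<longrightarrow>
            d \<in> cut_polytope n)"
  using assms(2)
  by (auto intro: realized_imp_mem_cut_polytope dest: mem_cut_polytope_imp_realized)

end
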